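(* There is an $\mathsf{n}$-simple model $M$ such that no $M$-predicate $H$ satisfies $\Phi_M(H)=\mathrm{True}_M$ (i.e. $M$ satisfies T-Tarski), but some $M$-predicate $H$ satisfies $\Phi_M(H)=\mathrm{False}_M$ (i.e. $M$ does not satisfy F-Tarski).
   Context: For a non-empty set $\Sigma$ of symbols, $\Sigma^\ast$ is the set of all finite strings over $\Sigma$, including the empty string; $XY$ denotes concatenation. Fix distinct symbols $\mathsf{n},\mathsf{r},\sharp$. A simple model is a pair $M=(\Sigma_M,\Phi_M)$ where $\Sigma_M$ is a set of symbols with $\sharp\in\Sigma_M$, and, putting $\mathrm{Pred}_M=\{X\sharp : X\in\Sigma_M^\ast \text{ and } X \text{ does not contain } \sharp\}$, $\Phi_M$ is a function $\mathrm{Pred}_M\to\mathcal{P}(\Sigma_M^\ast)$. Elements of $\mathrm{Pred}_M$ are called $M$-predicates. $\mathrm{Sent}_M=\{HX : H\in\mathrm{Pred}_M, X\in\Sigma_M^\ast\}$ is the set of $M$-sentences (the decomposition $HX$ is unique). $\mathrm{True}_M=\{HX\in\mathrm{Sent}_M : H\in\mathrm{Pred}_M, X\in\Phi_M(H)\}$ and $\mathrm{False}_M=\mathrm{Sent}_M\setminus\mathrm{True}_M$. A simple model $M$ is an $\mathsf{n}$-simple model if $\mathsf{n}\in\Sigma_M$ and for each $H\in\mathrm{Pred}_M$ we have $\mathsf{n}H\in\mathrm{Pred}_M$ and $\Phi_M(\mathsf{n}H)=\Sigma_M^\ast\setminus\Phi_M(H)$. *)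

theory Defs
  imports Main "HOL-Library.FuncSet"
begin

text \<open>
  Symbols are drawn from an arbitrary type \<open>'a\<close>; the fixed symbols (\<open>sharp\<close>, and \<open>n\<close> where it
  matters) are passed as parameters. Strings are lists, and \<open>lists A\<close> is the set of all finite
  strings over \<open>A\<close>, the empty string included.
\<close>

text \<open>
  The field \<open>ext\<close> is the function \<open>\<Phi>\<^sub>M\<close>. It is total as a HOL function, but only its values on
  \<open>M\<close>-predicates are constrained or used.
\<close>

record 'a model =
  alphabet :: "'a set"
  ext :: "'a list \<Rightarrow> 'a list set"

definition preds :: "'a \<Rightarrow> 'a model \<Rightarrow> 'a list set" where
  "preds sharp M = {X @ [sharp] | X. X \<in> lists (alphabet M) \<and> sharp \<notin> set X}"

definition sents :: "'a \<Rightarrow> 'a model \<Rightarrow> 'a list set" where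
  "sents sharp M = {H @ X | H X. H \<in> preds sharp M \<and> X \<in> lists (alphabet M)}"

definition true_sents :: "'a \<Rightarrow> 'a model \<Rightarrow> 'a list set" where
  "true_sents sharp M = {H @ X | H X. H @ X \<in> sents sharp M \<and> H \<in> preds sharp M \<and> X \<in> ext M H}"

definition false_sents :: "'a \<Rightarrow> 'a model \<Rightarrow> 'a list set" where
  "false_sents sharp M = sents sharp M - true_sents sharp M"

definition simple_model :: "'a \<Rightarrow> 'a model \<Rightarrow> bool" where
  "simple_model sharp M \<longleftrightarrow>
     sharp \<in> alphabet M \<and> ext M \<in> preds sharp M \<rightarrow> Pow (lists (alphabet M))"

definition n_simple_model :: "'a \<Rightarrow> 'a \<Rightarrow> 'a model \<Rightarrow> bool" where
  "n_simple_model n sharp M \<longleftrightarrow>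
     simple_model sharp M \<and> n \<in> alphabet M \<and>
     (\<forall>H \<in> preds sharp M. n # H \<in> preds sharp M \<and>
        ext M (n # H) = lists (alphabet M) - ext M H)"

definition T_Tarski :: "'a \<Rightarrow> 'a model \<Rightarrow> bool" where
  "T_Tarski sharp M \<longleftrightarrow> \<not> (\<exists>H \<in> preds sharp M. ext M H = true_sents sharp M)"

definition F_Tarski :: "'a \<Rightarrow> 'a model \<Rightarrow> bool" where
  "F_Tarski sharp M \<longleftrightarrow> \<not> (\<exists>H \<in> preds sharp M. ext M H = false_sents sharp M)"

end

(*
  Over the alphabet {n, sharp} the only predicates are n^k sharp, and negation forces the extension
  of all of them once the extension A of sharp is chosen: it is A for k even and the complement
  of A for k odd. The requirement that A be the set of false sentences then reads as a recursion on
  strings: (n^k sharp X) is in A iff (X is not in A) for k even, and iff (X is in A) for k odd, while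
  strings without sharp are not in A. The set of true sentences is not A, because the sentence sharp
  itself is false, and it is not the complement of A, because the empty string is not a sentence.
*)
theory Submission
  imports Defs
begin

text \<open>The flag records whether the number of symbols read since the last \<open>s\<close> is even.\<close>

fun falsum :: "'a \<Rightarrow> bool \<Rightarrow> 'a list \<Rightarrow> bool" where
  "falsum s b [] \<longleftrightarrow> False"
| "falsum s b (x # xs) \<longleftrightarrow> (if x = s then b \<noteq> falsum s True xs else falsum s (\<not> b) xs)"

lemma not_falsum_if_notin:
  "s \<notin> set Y \<Longrightarrow> \<not> falsum s b Y"
  by (induction Y arbitrary: b) auto

text \<open>Each symbol of \<open>Y\<close> flips the flag, and the \<open>s\<close> after it
  restarts the reading with \<open>True\<close>.\<close>

lemma falsum_append:
  "s \<notin> set Y \<Longrightarrow> falsum s b (Y @ s # X) \<longleftrightarrow> (b \<longleftrightarrow> even (length Y)) \<noteq> falsum s True X"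
  by (induction Y arbitrary: b) auto

definition falsum_set :: "'a \<Rightarrow> 'a \<Rightarrow> 'a list set" where
  "falsum_set n s = {X \<in> lists {n, s}. falsum s True X}"

text \<open>The length of a predicate counts its final \<open>s\<close>, so odd length means an even
  number of negations.\<close>

definition falsum_model :: "'a \<Rightarrow> 'a \<Rightarrow> 'a model" where
  "falsum_model n s = \<lparr>alphabet = {n, s},
     ext = (\<lambda>H. if odd (length H) then falsum_set n s else lists {n, s} - falsum_set n s)\<rparr>"

lemma alphabet_falsum_model [simp]: "alphabet (falsum_model n s) = {n, s}"
  by (simp add: falsum_model_def)

lemma ext_falsum_model:
  "ext (falsum_model n s) H =
     (if odd (length H) then falsum_set n s else lists {n, s} - falsum_set n s)"
  by (simp add: falsum_model_def)

lemma falsum_set_subset: "falsum_set n s \<subseteq> lists {n, s}"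
  by (auto simp: falsum_set_def)

text \<open>Prefixing \<open>n\<close> flips the parity of the length and so swaps
  \<open>falsum_set\<close> with its complement.\<close>

lemma n_simple_falsum_model:
  assumes "n \<noteq> s"
  shows "n_simple_model n s (falsum_model n s)"
proof -
  have "n # H \<in> preds s (falsum_model n s)" if "H \<in> preds s (falsum_model n s)" for H
  proof -
    from that obtain X where "H = X @ [s]" "X \<in> lists {n, s}" "s \<notin> set X"
      by (auto simp: preds_def)
    with assms have "n # H = (n # X) @ [s] \<and> n # X \<in> lists {n, s} \<and> s \<notin> set (n # X)"
      by auto
    then show ?thesis
      unfolding preds_def alphabet_falsum_model by blast
  qed
  then show ?thesis
    using falsum_set_subset[of n s]
    by (auto simp: n_simple_model_def simple_model_def ext_falsum_model)
qed

text \<open>The parity of \<open>H\<close> selects the extension and, by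
  \<open>falsum_append\<close>, also decides whether prefixing \<open>H\<close> reverses membership
  in \<open>falsum_set\<close>.\<close>

lemma mem_ext_falsum_model_iff:
  assumes "H \<in> preds s (falsum_model n s)" "X \<in> lists {n, s}"
  shows "X \<in> ext (falsum_model n s) H \<longleftrightarrow> H @ X \<notin> falsum_set n s"
  using assms by (auto simp: preds_def ext_falsum_model falsum_set_def falsum_append)

lemma true_sents_falsum_model:
  "true_sents s (falsum_model n s) = sents s (falsum_model n s) - falsum_set n s"
proof -
  have "X \<in> ext (falsum_model n s) H \<longleftrightarrow> X \<in> lists {n, s} \<and> H @ X \<notin> falsum_set n s"
    if "H \<in> preds s (falsum_model n s)" for H X
  proof (cases "X \<in> lists {n, s}")
    case True
    with that show ?thesis
      by (simp only: mem_ext_falsum_model_iff simp_thms)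
  next
    case False
    with falsum_set_subset[of n s] have "X \<notin> falsum_set n s"
      by blast
    with False show ?thesis
      by (simp add: ext_falsum_model del: in_lists_conv_set)
  qed
  then show ?thesis
    unfolding true_sents_def sents_def alphabet_falsum_model set_eq_iff mem_Collect_eq Diff_iff
    by metis
qed

text \<open>Only reading an \<open>s\<close> can yield \<open>True\<close>, and cutting after the
  first \<open>s\<close> leaves a predicate in front.\<close>

lemma falsum_set_subset_sents: "falsum_set n s \<subseteq> sents s (falsum_model n s)"
proof
  fix X assume X: "X \<in> falsum_set n s"
  then have "s \<in> set X"
    using not_falsum_if_notin[of s X True] by (auto simp: falsum_set_def)
  then obtain Y Z where "X = Y @ s # Z" "s \<notin> set Y"
    by (blast dest: split_list_first)
  moreover from this X have "Y \<in> lists {n, s}" "Z \<in> lists {n, s}"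
    by (auto simp: falsum_set_def)
  ultimately have "X = (Y @ [s]) @ Z" "Y @ [s] \<in> preds s (falsum_model n s)" "Z \<in> lists {n, s}"
    by (auto simp: preds_def)
  then show "X \<in> sents s (falsum_model n s)"
    unfolding sents_def alphabet_falsum_model by blast
qed

lemma false_sents_falsum_model: "false_sents s (falsum_model n s) = falsum_set n s"
  using falsum_set_subset_sents[of n s]
  by (auto simp: false_sents_def true_sents_falsum_model)

lemma T_Tarski_falsum_model: "T_Tarski s (falsum_model n s)"
proof -
  \<comment> \<open>Extensions take only two values, so one separating string for each
    suffices.\<close>
  have "[s] \<in> falsum_set n s" "[] \<in> lists {n, s} - falsum_set n s"
    by (auto simp: falsum_set_def)
  moreover have "[s] \<notin> true_sents s (falsum_model n s)"
    using calculation by (simp add: true_sents_falsum_model)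
  moreover have "[] \<notin> true_sents s (falsum_model n s)"
    by (auto simp: true_sents_falsum_model sents_def preds_def)
  ultimately show ?thesis
    unfolding T_Tarski_def ext_falsum_model by (metis (full_types))
qed

lemma not_F_Tarski_falsum_model: "\<not> F_Tarski s (falsum_model n s)"
proof -
  \<comment> \<open>The predicate without negations has length one, which is odd.\<close>
  have "[s] \<in> preds s (falsum_model n s)"
    by (auto simp: preds_def)
  moreover have "ext (falsum_model n s) [s] = false_sents s (falsum_model n s)"
    by (simp add: false_sents_falsum_model ext_falsum_model)
  ultimately show ?thesis
    unfolding F_Tarski_def by blast
qed

theorem proposition4p10:
  fixes n r sharp :: 'a
  assumes "distinct [n, r, sharp]"
  shows "\<exists>M :: 'a model. n_simple_model n sharp M \<and> T_Tarski sharp M \<and> \<not> F_Tarski sharp M"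
proof (intro exI conjI)
  show "n_simple_model n sharp (falsum_model n sharp)"
    using assms by (auto intro: n_simple_falsum_model)
qed (rule T_Tarski_falsum_model not_F_Tarski_falsum_model)+

end
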